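(* Let $G$ be a circulant graph $C_n(S)$. If $G$ is vertex decomposable, then $\mathrm{Shed}(G)$ is a dominating set of $G$.
   Context: For $n\ge 1$ and $S\subseteq\{1,\ldots,\lfloor n/2\rfloor\}$, the circulant graph $C_n(S)$ has vertex set $\{0,\ldots,n-1\}$ and edges $\{a,b\}$ with $|a-b|\in S$ or $n-|a-b|\in S$. All graphs are finite and simple. For a graph $G=(V,E)$ and $x\in V$, $G\setminus x$ is the graph obtained by deleting $x$ and its incident edges; $N(x)$ is the set of neighbours of $x$, $N[x]=N(x)\cup\{x\}$, and $G\setminus N[x]$ is obtained by deleting all vertices of $N[x]$ and their incident edges. A graph is well-covered if all its maximal independent sets have the same cardinality. A graph $G$ is vertex decomposable if $G$ is well-covered and either (i) $G$ has no edges (possibly no vertices), or (ii) there is a vertex $x$ such that both $G\setminus x$ and $G\setminus N[x]$ are vertex decomposable. For a vertex decomposable graph $G$, $\mathrm{Shed}(G)$ is the set of vertices $x$ such that $G\setminus x$ and $G\setminus N[x]$ are both vertex decomposable. A set $D\subseteq V$ is dominating if every vertex of $V\setminus D$ is adjacent to a vertex of $D$. *)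

theory Defs
  imports "Graph_Theory.Digraph_Component"
begin

text \<open>
  As usual in the graph library, a finite simple undirected graph is a symmetric digraph without
  loops and multiple arcs (locale \<^locale>\<open>graph\<close>): an edge $\{a,b\}$ is the pair of arcs
  $(a,b)$, $(b,a)$. The definitions below are meant for, and only applied to, such graphs.
\<close>

definition circulant :: "nat \<Rightarrow> nat set \<Rightarrow> (nat, nat \<times> nat) pre_digraph" where
  "circulant n S = with_proj
     \<lparr> pverts = {0..<n},
       parcs = {(a, b). a < n \<and> b < n \<and>
                  (nat \<bar>int a - int b\<bar> \<in> S \<or> n - nat \<bar>int a - int b\<bar> \<in> S)} \<rparr>"

lemma graph_circulant:
  assumes "n \<ge> 1" and "S \<subseteq> {1..n div 2}"
  shows "graph (circulant n S)"
proof -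
  let ?E = "{(a, b). a < n \<and> b < n \<and>
               (nat \<bar>int a - int b\<bar> \<in> S \<or> n - nat \<bar>int a - int b\<bar> \<in> S)}"
  have fin: "finite ?E"
    by (rule finite_subset[of _ "{0..<n} \<times> {0..<n}"]) auto
  have loop: "(a, a) \<notin> ?E" for a
    using assms by auto
  interpret pair_graph "\<lparr> pverts = {0..<n}, parcs = ?E \<rparr>"
    by unfold_locales
       (use fin loop in \<open>auto simp: symmetric_def arcs_ends_conv abs_minus_commute intro!: symI\<close>)
  show ?thesis
    unfolding circulant_def by (rule pair_graphD_graph)
qed

definition nbhd :: "('a, 'b) pre_digraph \<Rightarrow> 'a \<Rightarrow> 'a set" where
  "nbhd G x = {y \<in> verts G. x \<rightarrow>\<^bsub>G\<^esub> y}"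

definition closed_nbhd :: "('a, 'b) pre_digraph \<Rightarrow> 'a \<Rightarrow> 'a set" where
  "closed_nbhd G x = nbhd G x \<union> {x}"

definition del_closed_nbhd :: "('a, 'b) pre_digraph \<Rightarrow> 'a \<Rightarrow> ('a, 'b) pre_digraph" where
  "del_closed_nbhd G x = G \<restriction> (verts G - closed_nbhd G x)"

definition independent_set :: "('a, 'b) pre_digraph \<Rightarrow> 'a set \<Rightarrow> bool" where
  "independent_set G I \<longleftrightarrow> I \<subseteq> verts G \<and> (\<forall>u\<in>I. \<forall>v\<in>I. \<not> u \<rightarrow>\<^bsub>G\<^esub> v)"

definition maximal_independent_set :: "('a, 'b) pre_digraph \<Rightarrow> 'a set \<Rightarrow> bool" where
  "maximal_independent_set G I \<longleftrightarrow>
     independent_set G I \<and> (\<forall>J. independent_set G J \<and> I \<subseteq> J \<longrightarrow> J = I)"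

definition well_covered :: "('a, 'b) pre_digraph \<Rightarrow> bool" where
  "well_covered G \<longleftrightarrow>
     (\<forall>I J. maximal_independent_set G I \<and> maximal_independent_set G J \<longrightarrow> card I = card J)"

text \<open>
  Both deletions have fewer vertices than \<open>G\<close>, so on finite graphs the least fixed point
  below is the only solution of the recursive characterization.
\<close>

inductive vertex_decomposable :: "('a, 'b) pre_digraph \<Rightarrow> bool" where
  edgeless: "\<lbrakk> well_covered G; arcs G = {} \<rbrakk> \<Longrightarrow> vertex_decomposable G"
| shedding: "\<lbrakk> well_covered G; x \<in> verts G;
               vertex_decomposable (pre_digraph.del_vert G x);
               vertex_decomposable (del_closed_nbhd G x) \<rbrakk> \<Longrightarrow> vertex_decomposable G"

definition Shed :: "('a, 'b) pre_digraph \<Rightarrow> 'a set" where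
  "Shed G = {x \<in> verts G. vertex_decomposable (pre_digraph.del_vert G x) \<and>
                          vertex_decomposable (del_closed_nbhd G x)}"

definition dominating_set :: "('a, 'b) pre_digraph \<Rightarrow> 'a set \<Rightarrow> bool" where
  "dominating_set G D \<longleftrightarrow> D \<subseteq> verts G \<and> (\<forall>v \<in> verts G - D. \<exists>u\<in>D. v \<rightarrow>\<^bsub>G\<^esub> u)"

end

theory Submission
  imports Defs
begin

text \<open>
  Rotations act transitively on the vertices of a circulant graph and vertex decomposability is
  invariant under isomorphism, so \<open>Shed G\<close> is either empty or all of \<open>verts G\<close>. It is nonempty
  because a vertex decomposable graph is edgeless, in which case every vertex is a shedding vertex,
  or has a shedding vertex by definition.
\<close>

text \<open>No map on arcs is recorded, because arcs matter for vertex decomposability only through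
  adjacency; the arc types may even differ. Well-formedness puts the ends of every arc among the
  vertices, so the condition on pairs of vertices sees all arcs.\<close>

definition adj_iso :: "('a \<Rightarrow> 'c) \<Rightarrow> ('a, 'b) pre_digraph \<Rightarrow> ('c, 'd) pre_digraph \<Rightarrow> bool" where
  "adj_iso f G H \<longleftrightarrow> wf_digraph G \<and> wf_digraph H \<and> bij_betw f (verts G) (verts H) \<and>
     (\<forall>u\<in>verts G. \<forall>v\<in>verts G. f u \<rightarrow>\<^bsub>H\<^esub> f v \<longleftrightarrow> u \<rightarrow>\<^bsub>G\<^esub> v)"

lemma dominates_induce_subgraph_iff:
  "u \<rightarrow>\<^bsub>G \<restriction> W\<^esub> v \<longleftrightarrow> u \<in> W \<and> v \<in> W \<and> u \<rightarrow>\<^bsub>G\<^esub> v"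
  by (auto simp: arcs_ends_def arc_to_ends_def induce_subgraph_def)

text \<open>\<open>del_vert\<close> keeps the arcs avoiding \<open>x\<close>, an induced subgraph
  those with both ends in the set; well-formedness makes the two agree. Both kinds of deletion then
  fall under one lemma on induced subgraphs.\<close>

lemma del_vert_eq_induce_subgraph:
  assumes "wf_digraph G"
  shows "pre_digraph.del_vert G x = G \<restriction> (verts G - {x})"
  using assms
  by (auto simp: pre_digraph.del_vert_def induce_subgraph_def wf_digraph_def)

lemma adj_iso_induce_subgraph:
  assumes "adj_iso f G H" and "W \<subseteq> verts G"
  shows "adj_iso f (G \<restriction> W) (H \<restriction> (f ` W))"
proof -
  have wf: "wf_digraph (G \<restriction> W)" "wf_digraph (H \<restriction> (f ` W))"
    using assms(1)
    by (auto simp: adj_iso_def intro: wf_digraph.wellformed_induce_subgraph)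
  have "bij_betw f W (f ` W)"
    using assms by (auto simp: adj_iso_def bij_betw_def intro: inj_on_subset)
  moreover have "f u \<rightarrow>\<^bsub>H \<restriction> (f ` W)\<^esub> f v \<longleftrightarrow> u \<rightarrow>\<^bsub>G \<restriction> W\<^esub> v" if "u \<in> W" "v \<in> W" for u v
    using assms that by (auto simp: dominates_induce_subgraph_iff adj_iso_def)
  ultimately show ?thesis
    using wf by (simp add: adj_iso_def)
qed

lemma adj_iso_del_vert:
  assumes "adj_iso f G H" and "x \<in> verts G"
  shows "adj_iso f (pre_digraph.del_vert G x) (pre_digraph.del_vert H (f x))"
proof -
  have "verts H - {f x} = f ` (verts G - {x})"
    using assms by (auto simp: adj_iso_def bij_betw_def inj_on_def)
  then show ?thesis
    using adj_iso_induce_subgraph[OF assms(1), of "verts G - {x}"] assms(1)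
    by (simp add: adj_iso_def del_vert_eq_induce_subgraph)
qed

text \<open>An isomorphism maps closed neighbourhoods onto closed neighbourhoods, and by injectivity
  also their complements.\<close>

lemma adj_iso_del_closed_nbhd:
  assumes "adj_iso f G H" and "x \<in> verts G"
  shows "adj_iso f (del_closed_nbhd G x) (del_closed_nbhd H (f x))"
proof -
  have inj: "inj_on f (verts G)" and im: "verts H = f ` verts G"
    using assms(1) by (auto simp: adj_iso_def bij_betw_def)
  have "closed_nbhd H (f x) = f ` closed_nbhd G x"
    using assms im by (auto simp: adj_iso_def closed_nbhd_def nbhd_def)
  moreover have "closed_nbhd G x \<subseteq> verts G"
    using assms(2) by (auto simp: closed_nbhd_def nbhd_def)
  ultimately have "verts H - closed_nbhd H (f x) = f ` (verts G - closed_nbhd G x)"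
    using inj im by (simp add: inj_on_image_set_diff[of f "verts G"] Diff_subset)
  then show ?thesis
    using adj_iso_induce_subgraph[OF assms(1), of "verts G - closed_nbhd G x"]
    by (simp add: del_closed_nbhd_def)
qed

lemma adj_iso_independent_set_image:
  assumes "adj_iso f G H" and "I \<subseteq> verts G"
  shows "independent_set H (f ` I) \<longleftrightarrow> independent_set G I"
proof -
  have "f ` I \<subseteq> verts H"
    using assms by (auto simp: adj_iso_def bij_betw_def)
  moreover have "f u \<rightarrow>\<^bsub>H\<^esub> f v \<longleftrightarrow> u \<rightarrow>\<^bsub>G\<^esub> v" if "u \<in> I" "v \<in> I" for u v
    using assms that by (auto simp: adj_iso_def)
  ultimately show ?thesis
    using assms(2) by (simp add: independent_set_def)
qed

text \<open>Maximal independent sets are pulled back from \<open>H\<close> to \<open>G\<close>,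
  which transfers \<open>well_covered\<close> without an inverse isomorphism. An independent set
  above the preimage \<open>I\<close> has an independent image above \<open>J\<close>, hence equal
  to \<open>J\<close>, and injectivity gives back \<open>I\<close>.\<close>

lemma adj_iso_maximal_independent_setE:
  assumes iso: "adj_iso f G H" and J: "maximal_independent_set H J"
  obtains I where "maximal_independent_set G I" and "J = f ` I" and "card J = card I"
proof -
  have inj: "inj_on f (verts G)" and im: "f ` verts G = verts H"
    using iso by (auto simp: adj_iso_def bij_betw_def)
  have "J \<subseteq> f ` verts G"
    using J im by (simp add: maximal_independent_set_def independent_set_def)
  then obtain I where I: "I \<subseteq> verts G" "J = f ` I"
    by (meson subset_imageE)
  have "K = I" if K: "independent_set G K" "I \<subseteq> K" for K
  proof -
    have sub: "K \<subseteq> verts G"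
      using K by (simp add: independent_set_def)
    then have "independent_set H (f ` K)"
      using adj_iso_independent_set_image[OF iso] K by blast
    then have "f ` K = f ` I"
      using J I(2) K(2) unfolding maximal_independent_set_def by blast
    then show ?thesis
      using inj sub I(1) by (simp add: inj_on_image_eq_iff)
  qed
  moreover have "independent_set G I"
    using J I adj_iso_independent_set_image[OF iso] by (auto simp: maximal_independent_set_def)
  ultimately have "maximal_independent_set G I"
    by (simp add: maximal_independent_set_def)
  moreover have "card J = card I"
    using I inj by (metis card_image inj_on_subset)
  ultimately show thesis
    using that I(2) by blast
qed

lemma adj_iso_well_covered:
  assumes "adj_iso f G H" and "well_covered G"
  shows "well_covered H"
  using assms unfolding well_covered_def
  by (metis adj_iso_maximal_independent_setE)

lemma adj_iso_arcs_empty: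
  assumes "adj_iso f G H" and "arcs G = {}"
  shows "arcs H = {}"
proof (rule ccontr)
  assume "arcs H \<noteq> {}"
  then obtain e where e: "e \<in> arcs H"
    by blast
  interpret H: wf_digraph H
    using assms(1) by (simp add: adj_iso_def)
  have "tail H e \<in> f ` verts G" "head H e \<in> f ` verts G"
    using assms(1) e by (auto simp: adj_iso_def bij_betw_def)
  moreover have "tail H e \<rightarrow>\<^bsub>H\<^esub> head H e"
    using e by (rule H.in_arcs_imp_in_arcs_ends)
  ultimately obtain u v where "u \<rightarrow>\<^bsub>G\<^esub> v"
    using assms(1) by (auto simp: adj_iso_def)
  then show False
    using assms(2) by (simp add: arcs_ends_def)
qed

text \<open>\<open>H\<close> is generalised in the induction since the hypotheses are applied to the
  two deletions of \<open>H\<close> at \<open>f x\<close>.\<close>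

lemma adj_iso_vertex_decomposable:
  assumes "vertex_decomposable G" and "adj_iso f G H"
  shows "vertex_decomposable H"
  using assms
proof (induction arbitrary: H rule: vertex_decomposable.induct)
  case (edgeless G)
  then show ?case
    by (meson adj_iso_arcs_empty adj_iso_well_covered vertex_decomposable.edgeless)
next
  case (shedding G x)
  have "f x \<in> verts H"
    using shedding by (auto simp: adj_iso_def bij_betw_def)
  then show ?case
    using shedding
    by (meson adj_iso_del_closed_nbhd adj_iso_del_vert adj_iso_well_covered
        vertex_decomposable.shedding)
qed

lemma adj_iso_Shed:
  assumes "adj_iso f G H" and "x \<in> Shed G"
  shows "f x \<in> Shed H"
proof -
  have "f x \<in> verts H"
    using assms by (auto simp: adj_iso_def bij_betw_def Shed_def)
  then show ?thesis
    using assms unfolding Shed_def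
    by (blast intro: adj_iso_vertex_decomposable adj_iso_del_vert adj_iso_del_closed_nbhd)
qed

text \<open>The whole vertex set is the only maximal independent set, so well-coveredness is
  automatic.\<close>

lemma vertex_decomposable_arcs_empty:
  assumes "arcs G = {}"
  shows "vertex_decomposable G"
proof (rule vertex_decomposable.edgeless)
  have "independent_set G I \<longleftrightarrow> I \<subseteq> verts G" for I
    using assms by (simp add: independent_set_def arcs_ends_def)
  then have "maximal_independent_set G I \<Longrightarrow> I = verts G" for I
    unfolding maximal_independent_set_def by blast
  then show "well_covered G"
    unfolding well_covered_def by blast
qed (fact assms)

text \<open>Both deletions are again without arcs. This supplies shedding vertices when
  decomposability comes from the rule \<open>edgeless\<close>, which names none.\<close>

lemma Shed_arcs_empty:
  assumes "arcs G = {}"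
  shows "Shed G = verts G"
  using assms
  by (auto simp: Shed_def del_closed_nbhd_def induce_subgraph_def pre_digraph.del_vert_def
      intro!: vertex_decomposable_arcs_empty)

lemma Shed_nonempty:
  assumes "vertex_decomposable G" and "verts G \<noteq> {}"
  shows "Shed G \<noteq> {}"
  using assms(1)
proof cases
  case edgeless
  then show ?thesis
    using assms(2) by (simp add: Shed_arcs_empty)
next
  case (shedding x)
  then show ?thesis
    by (auto simp: Shed_def)
qed

lemma verts_circulant: "verts (circulant n S) = {0..<n}"
  by (simp add: circulant_def)

lemma dominates_circulant_iff:
  "a \<rightarrow>\<^bsub>circulant n S\<^esub> b \<longleftrightarrow>
     a < n \<and> b < n \<and> (nat \<bar>int a - int b\<bar> \<in> S \<or> n - nat \<bar>int a - int b\<bar> \<in> S)"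
  by (auto simp: circulant_def arcs_ends_def arc_to_ends_def)

text \<open>Reduction modulo \<open>n\<close> subtracts \<open>n\<close> from each of
  \<open>a + k\<close> and \<open>b + k\<close> at most once. If it affects both or neither, the
  distance is kept; if exactly one, it becomes \<open>n - d\<close>.\<close>

lemma add_mod_distance_cases:
  fixes a b k n :: nat
  assumes "a < n" "b < n" "k < n"
  defines "d \<equiv> nat \<bar>int a - int b\<bar>"
    and "d' \<equiv> nat \<bar>int ((a + k) mod n) - int ((b + k) mod n)\<bar>"
  shows "d' = d \<or> 0 < d \<and> d < n \<and> d' = n - d"
proof -
  have "(c + k) mod n = (if c + k < n then c + k else c + k - n)" if "c < n" for c
    using that assms(3) by (simp add: mod_if)
  then show ?thesis
    using assms(1-3) unfolding d_def d'_def by (auto split: if_splits)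
qed

lemma adj_iso_circulant_rotation:
  assumes "n \<ge> 1" and "S \<subseteq> {1..n div 2}" and "k < n"
  shows "adj_iso (\<lambda>a. (a + k) mod n) (circulant n S) (circulant n S)"
proof -
  let ?f = "\<lambda>a. (a + k) mod n"
  interpret graph "circulant n S"
    using assms(1,2) by (rule graph_circulant)
  have "inj_on ?f {0..<n}"
  proof (rule inj_onI)
    fix a b
    assume ab: "a \<in> {0..<n}" "b \<in> {0..<n}" and eq: "?f a = ?f b"
    show "a = b"
      \<comment> \<open>Equal images have distance 0, which cannot be \<open>n - d\<close> because
        \<open>d < n\<close>; hence \<open>d = 0\<close>.\<close>
      using add_mod_distance_cases[of a n b k] ab eq assms(3) by auto
  qed
  moreover from this have "?f ` {0..<n} = {0..<n}"
    using assms(1) by (intro endo_inj_surj) auto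
  ultimately have "bij_betw ?f (verts (circulant n S)) (verts (circulant n S))"
    by (simp add: bij_betw_def verts_circulant)
  moreover have "?f a \<rightarrow>\<^bsub>circulant n S\<^esub> ?f b \<longleftrightarrow> a \<rightarrow>\<^bsub>circulant n S\<^esub> b" if "a < n" "b < n" for a b
    \<comment> \<open>In the wrapping case \<open>d\<close> and \<open>n - d\<close> trade places,
      and the edge condition is symmetric in them.\<close>
    using add_mod_distance_cases[OF that assms(3)] that
    by (auto simp: dominates_circulant_iff)
  ultimately show ?thesis
    by (simp add: adj_iso_def verts_circulant wf_digraph_axioms)
qed

lemma Shed_circulant:
  assumes "n \<ge> 1" and "S \<subseteq> {1..n div 2}" and "vertex_decomposable (circulant n S)"
  shows "Shed (circulant n S) = verts (circulant n S)"
proof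
  show "Shed (circulant n S) \<subseteq> verts (circulant n S)"
    by (auto simp: Shed_def)
  show "verts (circulant n S) \<subseteq> Shed (circulant n S)"
  proof
    fix v
    assume "v \<in> verts (circulant n S)"
    then have v: "v < n"
      by (simp add: verts_circulant)
    obtain x where x: "x \<in> Shed (circulant n S)"
      using Shed_nonempty[OF assms(3)] assms(1) by (auto simp: verts_circulant)
    then have "x < n"
      by (simp add: Shed_def verts_circulant)
    \<comment> \<open>The rotation taking \<open>x\<close> to \<open>v\<close> is by
      \<open>v - x\<close> modulo \<open>n\<close>; adding \<open>n - x\<close> avoids truncated
      subtraction on naturals.\<close>
    define k where "k = (v + (n - x)) mod n"
    have "(x + k) mod n = (x + (v + (n - x))) mod n"
      unfolding k_def by (rule mod_add_right_eq)
    also have "x + (v + (n - x)) = v + n"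
      using \<open>x < n\<close> by simp
    finally have "(x + k) mod n = v"
      using v by simp
    moreover have "k < n"
      using assms(1) by (simp add: k_def)
    ultimately show "v \<in> Shed (circulant n S)"
      using adj_iso_Shed[OF adj_iso_circulant_rotation[OF assms(1,2)] x] by metis
  qed
qed

theorem theorem2p10:
  fixes n :: nat and S :: "nat set"
  assumes "n \<ge> 1" and "S \<subseteq> {1..n div 2}"
    and "vertex_decomposable (circulant n S)"
  shows "dominating_set (circulant n S) (Shed (circulant n S))"
  \<comment> \<open>No vertex lies outside \<open>Shed\<close>, so nothing remains to be
    dominated.\<close>
  using Shed_circulant[OF assms] by (simp add: dominating_set_def)

end
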